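(* Every bounded-complete dcpo belongs to $\mathcal R_2$, where a dcpo is bounded-complete if it has a least element $\bot$ and every nonempty bounded subset (i.e. every nonempty subset having an upper bound) has a supremum.
   Context: Directed subsets are nonempty; a dcpo is a poset in which every directed subset has a supremum. $\mathbf{DCPO}$ is the category of dcpos and Scott-continuous maps. For dcpos $A,B$, $[A\to B]$ is the dcpo of Scott-continuous maps ordered pointwise. All full subcategories are closed under isomorphisms. Let $2=\{0<1\}$. $E_2$ is the class of all Scott-continuous maps $e:A\to B$ between dcpos such that $e^*:[B\to 2]\to[A\to 2]$, $g\mapsto g\circ e$, is an isomorphism of dcpos (equivalently, $e^{-1}$ is an order isomorphism from the lattice of Scott-open sets of $B$ onto that of $A$). $\mathcal R_2=E_2^{\perp}$ is the full subcategory of $\mathbf{DCPO}$ of all dcpos $C$ such that for every $e:A\to B$ in $E_2$ the map $e^*:[B\to C]\to[A\to C]$, $g\mapsto g\circ e$, is an isomorphism of dcpos. (It is the least reflective full subcategory of $\mathbf{DCPO}$ containing $2$.) *)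

theory Defs
  imports "HOL-Algebra.Order"
begin

definition directed_in :: "'a gorder \<Rightarrow> 'a set \<Rightarrow> bool" where
  "directed_in A D \<longleftrightarrow> D \<subseteq> carrier A \<and> D \<noteq> {} \<and>
     (\<forall>x\<in>D. \<forall>y\<in>D. \<exists>z\<in>D. x \<sqsubseteq>\<^bsub>A\<^esub> z \<and> y \<sqsubseteq>\<^bsub>A\<^esub> z)"

(* The carrier may be empty: the empty poset is a dcpo. *)
locale dcpo = partial_order A for A :: "'a gorder" (structure) +
  assumes directed_lub: "directed_in A D \<Longrightarrow> \<exists>s. is_lub A s D"

locale bounded_complete_dcpo = dcpo A for A :: "'a gorder" (structure) +
  assumes bottom_ex: "\<exists>b. least A b (carrier A)"
    and bounded_lub: "\<lbrakk>S \<subseteq> carrier A; S \<noteq> {}; Upper A S \<noteq> {}\<rbrakk> \<Longrightarrow> \<exists>s. is_lub A s S"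

(* Maps are extensional (undefined outside the carrier), so that HOL equality of
   elements of scott_maps A B is equality of maps from carrier A to carrier B. *)
definition scott_maps :: "'a gorder \<Rightarrow> 'b gorder \<Rightarrow> ('a \<Rightarrow> 'b) set" where
  "scott_maps A B = {f \<in> carrier A \<rightarrow>\<^sub>E carrier B. isotone A B f \<and>
     (\<forall>D s. directed_in A D \<longrightarrow> is_lub A s D \<longrightarrow> is_lub B (f s) (f ` D))}"

definition scott_space :: "'a gorder \<Rightarrow> 'b gorder \<Rightarrow> ('a \<Rightarrow> 'b) gorder" where
  "scott_space A B = \<lparr>carrier = scott_maps A B, eq = (=),
     le = (\<lambda>f g. \<forall>x\<in>carrier A. f x \<sqsubseteq>\<^bsub>B\<^esub> g x)\<rparr>"

(* Isomorphisms in the category of dcpos and Scott-continuous maps. *)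
definition dcpo_iso :: "'a gorder \<Rightarrow> 'b gorder \<Rightarrow> ('a \<Rightarrow> 'b) \<Rightarrow> bool" where
  "dcpo_iso A B f \<longleftrightarrow> dcpo A \<and> dcpo B \<and> f \<in> scott_maps A B \<and>
     (\<exists>g \<in> scott_maps B A.
        (\<forall>x\<in>carrier A. g (f x) = x) \<and> (\<forall>y\<in>carrier B. f (g y) = y))"

(* The map e^* from [B -> C] to [A -> C], sending g to g o e. *)
definition precomp ::
    "'a gorder \<Rightarrow> 'b gorder \<Rightarrow> 'c gorder \<Rightarrow> ('a \<Rightarrow> 'b) \<Rightarrow> ('b \<Rightarrow> 'c) \<Rightarrow> ('a \<Rightarrow> 'c)" where
  "precomp A B C e = (\<lambda>g\<in>scott_maps B C. compose (carrier A) g e)"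

definition two :: "bool gorder" where
  "two = \<lparr>carrier = UNIV, eq = (=), le = (\<le>)\<rparr>"

definition E2 :: "'a gorder \<Rightarrow> 'b gorder \<Rightarrow> ('a \<Rightarrow> 'b) set" where
  "E2 A B = {e. dcpo A \<and> dcpo B \<and> e \<in> scott_maps A B \<and>
     dcpo_iso (scott_space B two) (scott_space A two) (precomp A B two e)}"

(* HOL cannot quantify over types inside a definition, so the element types of the
   dcpos A and B tested against C are parameters. Membership in the class of the
   paper is membership in R2 TYPE('a) TYPE('b) for arbitrary 'a and 'b. *)
definition R2 :: "'a itself \<Rightarrow> 'b itself \<Rightarrow> 'c gorder set" where
  "R2 TA TB = {C. dcpo C \<and>
     (\<forall>(A :: 'a gorder) (B :: 'b gorder). \<forall>e \<in> E2 A B.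
        dcpo_iso (scott_space B C) (scott_space A C) (precomp A B C e))}"

end

theory Submission
  imports Defs
begin

text \<open>
  For \<open>e \<in> E2 A B\<close> and a Scott-continuous \<open>f\<close> from \<open>A\<close> to \<open>C\<close>, the extension of \<open>f\<close> along \<open>e\<close>
  sends \<open>b\<close> to the supremum of the image under \<open>f\<close> of the closed set of all \<open>a\<close> with \<open>e a \<le> b\<close>.
  The supremum of \<open>f\<close> over a set is also its supremum over the Scott closure of the set, so the
  isomorphism between the lattices of Scott-closed sets makes this map Scott-continuous.
  The supremum exists for every \<open>b\<close>: the \<open>b\<close> for which the image is bounded form a Scott-closed
  subset of \<open>B\<close> that contains the image of \<open>e\<close>, hence all of \<open>B\<close>. (Equivalently, extend \<open>f\<close> into
  the complete lattice obtained from \<open>C\<close> by adding a new top element. The singleton of that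
  top element is Scott-open, so its preimage is an open set that misses the image of \<open>e\<close>.)
\<close>

section \<open>Suprema, directed sets and Scott-continuous maps\<close>

lemma is_lub_iff:
  assumes "S \<subseteq> carrier L"
  shows "is_lub L s S \<longleftrightarrow> s \<in> carrier L \<and> (\<forall>x\<in>S. x \<sqsubseteq>\<^bsub>L\<^esub> s) \<and>
    (\<forall>u\<in>carrier L. (\<forall>x\<in>S. x \<sqsubseteq>\<^bsub>L\<^esub> u) \<longrightarrow> s \<sqsubseteq>\<^bsub>L\<^esub> u)"
  using assms unfolding least_def Upper_def by blast

lemma directed_in_subset: "directed_in A D \<Longrightarrow> D \<subseteq> carrier A"
  by (simp add: directed_in_def)

lemma directed_in_image:
  assumes "directed_in A D" "h ` D \<subseteq> carrier B"
    and "\<And>x y. \<lbrakk>x \<in> D; y \<in> D; x \<sqsubseteq>\<^bsub>A\<^esub> y\<rbrakk> \<Longrightarrow> h x \<sqsubseteq>\<^bsub>B\<^esub> h y"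
  shows "directed_in B (h ` D)"
proof -
  have "\<exists>z\<in>h ` D. u \<sqsubseteq>\<^bsub>B\<^esub> z \<and> v \<sqsubseteq>\<^bsub>B\<^esub> z" if "u \<in> h ` D" "v \<in> h ` D" for u v
  proof -
    from that obtain x y where "x \<in> D" "u = h x" "y \<in> D" "v = h y" by blast
    moreover from this assms(1) obtain z where "z \<in> D" "x \<sqsubseteq>\<^bsub>A\<^esub> z" "y \<sqsubseteq>\<^bsub>A\<^esub> z"
      unfolding directed_in_def by blast
    ultimately show ?thesis using assms(3) by blast
  qed
  then show ?thesis using assms(1,2) by (auto simp: directed_in_def)
qed

lemma scott_mapsI:
  assumes "partial_order A" "partial_order B" "f \<in> carrier A \<rightarrow>\<^sub>E carrier B"
    and "\<And>x y. \<lbrakk>x \<in> carrier A; y \<in> carrier A; x \<sqsubseteq>\<^bsub>A\<^esub> y\<rbrakk> \<Longrightarrow> f x \<sqsubseteq>\<^bsub>B\<^esub> f y"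
    and "\<And>D s u. \<lbrakk>directed_in A D; is_lub A s D; u \<in> carrier B; \<And>d. d \<in> D \<Longrightarrow> f d \<sqsubseteq>\<^bsub>B\<^esub> u\<rbrakk>
      \<Longrightarrow> f s \<sqsubseteq>\<^bsub>B\<^esub> u"
  shows "f \<in> scott_maps A B"
proof -
  interpret A: partial_order A by fact
  interpret B: partial_order B by fact
  have "is_lub B (f s) (f ` D)" if D: "directed_in A D" and s: "is_lub A s D" for D s
  proof -
    have DA: "D \<subseteq> carrier A" using D by (rule directed_in_subset)
    have s': "s \<in> carrier A" "\<forall>d\<in>D. d \<sqsubseteq>\<^bsub>A\<^esub> s" using s is_lub_iff[OF DA] by auto
    have fD: "f ` D \<subseteq> carrier B" using DA assms(3) by auto
    show ?thesis unfolding is_lub_iff[OF fD]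
      using s' DA assms(3) assms(4) assms(5)[OF D s] by (auto dest: PiE_mem)
  qed
  then show ?thesis
    using assms(3,4) unfolding scott_maps_def isotone_def
    by (auto intro: A.weak_partial_order_axioms B.weak_partial_order_axioms)
qed

lemma scott_maps_mem: "f \<in> scott_maps A B \<Longrightarrow> x \<in> carrier A \<Longrightarrow> f x \<in> carrier B"
  unfolding scott_maps_def by auto

lemma scott_maps_mono:
  "\<lbrakk>f \<in> scott_maps A B; x \<in> carrier A; y \<in> carrier A; x \<sqsubseteq>\<^bsub>A\<^esub> y\<rbrakk> \<Longrightarrow> f x \<sqsubseteq>\<^bsub>B\<^esub> f y"
  unfolding scott_maps_def isotone_def by auto

lemma scott_maps_lub_le:
  assumes "f \<in> scott_maps A B" "directed_in A D" "is_lub A s D" "u \<in> carrier B"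
    and "\<And>d. d \<in> D \<Longrightarrow> f d \<sqsubseteq>\<^bsub>B\<^esub> u"
  shows "f s \<sqsubseteq>\<^bsub>B\<^esub> u"
proof -
  have "f ` D \<subseteq> carrier B"
    using assms(1) directed_in_subset[OF assms(2)] by (auto dest: scott_maps_mem)
  moreover have "is_lub B (f s) (f ` D)" using assms(1-3) unfolding scott_maps_def by blast
  ultimately show ?thesis using assms(4,5) by (simp add: is_lub_iff)
qed

lemma scott_maps_ext:
  "\<lbrakk>f \<in> scott_maps A B; g \<in> scott_maps A B; \<And>x. x \<in> carrier A \<Longrightarrow> f x = g x\<rbrakk> \<Longrightarrow> f = g"
  unfolding scott_maps_def by (auto intro: PiE_ext)

lemma compose_scott_maps:
  assumes "dcpo A" "dcpo B" "dcpo C" "e \<in> scott_maps A B" "g \<in> scott_maps B C"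
  shows "compose (carrier A) g e \<in> scott_maps A C"
proof -
  interpret A: dcpo A by fact
  interpret B: dcpo B by fact
  interpret C: dcpo C by fact
  note mem = scott_maps_mem[OF assms(4)] scott_maps_mem[OF assms(5)]
  show ?thesis
  proof (rule scott_mapsI)
    show "partial_order A" "partial_order C" by unfold_locales
    show "compose (carrier A) g e \<in> carrier A \<rightarrow>\<^sub>E carrier C"
      using mem by (auto simp: compose_def)
    show "compose (carrier A) g e x \<sqsubseteq>\<^bsub>C\<^esub> compose (carrier A) g e y"
      if "x \<in> carrier A" "y \<in> carrier A" "x \<sqsubseteq>\<^bsub>A\<^esub> y" for x y
      using that mem scott_maps_mono[OF assms(4)] scott_maps_mono[OF assms(5)]
      by (simp add: compose_eq)
    show "compose (carrier A) g e s \<sqsubseteq>\<^bsub>C\<^esub> u"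
      if D: "directed_in A D" and s: "is_lub A s D" and u: "u \<in> carrier C"
        and le: "\<And>d. d \<in> D \<Longrightarrow> compose (carrier A) g e d \<sqsubseteq>\<^bsub>C\<^esub> u" for D s u
    proof -
      have DA: "D \<subseteq> carrier A" using D by (rule directed_in_subset)
      have eD: "directed_in B (e ` D)"
      proof (rule directed_in_image[OF D])
        show "e ` D \<subseteq> carrier B" using DA mem by blast
        show "e x \<sqsubseteq>\<^bsub>B\<^esub> e y" if "x \<in> D" "y \<in> D" "x \<sqsubseteq>\<^bsub>A\<^esub> y" for x y
          using that DA by (intro scott_maps_mono[OF assms(4)]) auto
      qed
      have es: "is_lub B (e s) (e ` D)" using assms(4) D s unfolding scott_maps_def by blast
      have "g y \<sqsubseteq>\<^bsub>C\<^esub> u" if "y \<in> e ` D" for y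
        using that le DA by (metis compose_eq imageE subsetD)
      then have "g (e s) \<sqsubseteq>\<^bsub>C\<^esub> u" by (rule scott_maps_lub_le[OF assms(5) eD es u])
      then show ?thesis using s is_lub_iff[OF DA] by (simp add: compose_eq)
    qed
  qed
qed

section \<open>The dcpo of Scott-continuous maps\<close>

lemma scott_space_simps [simp]:
  "carrier (scott_space A B) = scott_maps A B"
  "le (scott_space A B) f g \<longleftrightarrow> (\<forall>x\<in>carrier A. f x \<sqsubseteq>\<^bsub>B\<^esub> g x)"
  by (simp_all add: scott_space_def)

text \<open>Directed suprema of maps are computed pointwise. The pointwise supremum is again
  Scott-continuous because the supremum over the maps and the supremum over a directed set of
  arguments commute.\<close>

lemma dcpo_scott_space:
  assumes "dcpo A" "dcpo B"
  shows "dcpo (scott_space A B)"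
proof -
  interpret A: dcpo A by fact
  interpret B: dcpo B by fact
  interpret S: partial_order "scott_space A B"
  proof
    show "eq (scott_space A B) f g" if "le (scott_space A B) f g" "le (scott_space A B) g f"
      "f \<in> carrier (scott_space A B)" "g \<in> carrier (scott_space A B)" for f g
    proof -
      have "f = g"
        using that by (intro scott_maps_ext[of f A B g] B.le_antisym) (auto simp: scott_maps_mem)
      then show ?thesis by (simp add: scott_space_def)
    qed
    show "le (scott_space A B) f h" if "le (scott_space A B) f g" "le (scott_space A B) g h"
      "f \<in> carrier (scott_space A B)" "g \<in> carrier (scott_space A B)"
      "h \<in> carrier (scott_space A B)" for f g h
      using that by (auto intro: B.le_trans simp: scott_maps_mem)
  qed (auto simp: scott_space_def scott_maps_mem)
  show ?thesis
  proof
    fix F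
    assume F: "directed_in (scott_space A B) F"
    have FM: "F \<subseteq> scott_maps A B" using directed_in_subset[OF F] by simp
    have sub: "(\<lambda>f. f x) ` F \<subseteq> carrier B" if "x \<in> carrier A" for x
      using that FM by (auto dest: scott_maps_mem)
    have "\<exists>t. is_lub B t ((\<lambda>f. f x) ` F)" if "x \<in> carrier A" for x
      by (rule B.directed_lub, rule directed_in_image[OF F sub[OF that]])
        (use that in auto)
    then obtain t where t: "\<And>x. x \<in> carrier A \<Longrightarrow> is_lub B (t x) ((\<lambda>f. f x) ` F)"
      by metis
    have tB: "t x \<in> carrier B" and tup: "\<And>f. f \<in> F \<Longrightarrow> f x \<sqsubseteq>\<^bsub>B\<^esub> t x"
      and tle: "\<And>u. \<lbrakk>u \<in> carrier B; \<And>f. f \<in> F \<Longrightarrow> f x \<sqsubseteq>\<^bsub>B\<^esub> u\<rbrakk> \<Longrightarrow> t x \<sqsubseteq>\<^bsub>B\<^esub> u"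
      if "x \<in> carrier A" for x
      using t[OF that] is_lub_iff[OF sub[OF that]] by auto
    have tS: "restrict t (carrier A) \<in> scott_maps A B"
    proof (rule scott_mapsI)
      show "partial_order A" "partial_order B" by unfold_locales
      show "restrict t (carrier A) \<in> carrier A \<rightarrow>\<^sub>E carrier B" using tB by auto
      show "restrict t (carrier A) x \<sqsubseteq>\<^bsub>B\<^esub> restrict t (carrier A) y"
        if xy: "x \<in> carrier A" "y \<in> carrier A" "x \<sqsubseteq>\<^bsub>A\<^esub> y" for x y
      proof -
        have "f x \<sqsubseteq>\<^bsub>B\<^esub> t y" if "f \<in> F" for f
        proof -
          have f: "f \<in> scott_maps A B" using that FM by auto
          show ?thesis
            using B.le_trans[OF scott_maps_mono[OF f xy] tup[OF xy(2) that]]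
              scott_maps_mem[OF f] xy tB
            by simp
        qed
        then show ?thesis using xy tB by (simp add: tle)
      qed
      show "restrict t (carrier A) s \<sqsubseteq>\<^bsub>B\<^esub> u"
        if D: "directed_in A D" and s: "is_lub A s D" and u: "u \<in> carrier B"
          and le: "\<And>d. d \<in> D \<Longrightarrow> restrict t (carrier A) d \<sqsubseteq>\<^bsub>B\<^esub> u" for D s u
      proof -
        have DA: "D \<subseteq> carrier A" using D by (rule directed_in_subset)
        have sA: "s \<in> carrier A" using s is_lub_iff[OF DA] by blast
        \<comment> \<open>The exchange of suprema: each single \<open>f\<close> is bounded by
          \<open>u\<close> at \<open>s\<close> by its own continuity, and only then is the supremum
          over \<open>F\<close> taken.\<close>
        have "f s \<sqsubseteq>\<^bsub>B\<^esub> u" if "f \<in> F" for f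
        proof -
          have f: "f \<in> scott_maps A B" using that FM by auto
          have "f d \<sqsubseteq>\<^bsub>B\<^esub> u" if "d \<in> D" for d
          proof -
            have d: "d \<in> carrier A" using that DA by auto
            then show ?thesis
              using le[OF that] tup[OF d \<open>f \<in> F\<close>] scott_maps_mem[OF f d] tB[OF d] u
              by (auto intro: B.le_trans)
          qed
          then show ?thesis by (rule scott_maps_lub_le[OF f D s u])
        qed
        then show ?thesis using sA u by (simp add: tle)
      qed
    qed
    have "is_lub (scott_space A B) (restrict t (carrier A)) F"
      unfolding is_lub_iff[OF directed_in_subset[OF F]]
      using tS tup tle by (auto simp: scott_maps_mem)
    then show "\<exists>s. is_lub (scott_space A B) s F" by blast
  qed
qed

text \<open>An order isomorphism preserves all existing suprema. By \<open>lef\<close> and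
  \<open>leg\<close>, \<open>f\<close> and its inverse are each left adjoint to the other, and left
  adjoints preserve suprema. Injectivity comes from antisymmetry, since \<open>f\<close> reflects
  the order.\<close>

lemma dcpo_iso_of_order_iso:
  assumes "dcpo P" "dcpo Q" "f \<in> carrier P \<rightarrow>\<^sub>E carrier Q"
    and "carrier Q \<subseteq> f ` carrier P"
    and le: "\<And>x y. \<lbrakk>x \<in> carrier P; y \<in> carrier P\<rbrakk> \<Longrightarrow> f x \<sqsubseteq>\<^bsub>Q\<^esub> f y \<longleftrightarrow> x \<sqsubseteq>\<^bsub>P\<^esub> y"
  shows "dcpo_iso P Q f"
proof -
  interpret P: dcpo P by fact
  interpret Q: dcpo Q by fact
  \<comment> \<open>The restriction makes the inverse extensional, as membership in
    \<open>scott_maps\<close> demands.\<close>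
  define g where "g = restrict (inv_into (carrier P) f) (carrier Q)"
  have fQ: "f x \<in> carrier Q" if "x \<in> carrier P" for x using that assms(3) by auto
  have gP: "g y \<in> carrier P" and fg: "f (g y) = y" if "y \<in> carrier Q" for y
    using that assms(4) by (auto simp: g_def inv_into_into f_inv_into_f subset_eq)
  have "x = y" if "x \<in> carrier P" "y \<in> carrier P" "f x = f y" for x y
    using that le[of x y] le[of y x] fQ by (auto intro: P.le_antisym)
  then have gf: "g (f x) = x" if "x \<in> carrier P" for x
    using that fg gP fQ by metis
  have leg: "g x \<sqsubseteq>\<^bsub>P\<^esub> u \<longleftrightarrow> x \<sqsubseteq>\<^bsub>Q\<^esub> f u" if "x \<in> carrier Q" "u \<in> carrier P" for x u
    using le[of "g x" u] gP fg that by simp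
  have lef: "f x \<sqsubseteq>\<^bsub>Q\<^esub> u \<longleftrightarrow> x \<sqsubseteq>\<^bsub>P\<^esub> g u" if "x \<in> carrier P" "u \<in> carrier Q" for x u
    using le[of x "g u"] gP fg that by simp
  have f: "f \<in> scott_maps P Q"
  proof (rule scott_mapsI)
    show "partial_order P" "partial_order Q" by unfold_locales
    show "f s \<sqsubseteq>\<^bsub>Q\<^esub> u"
      if D: "directed_in P D" and s: "is_lub P s D" and u: "u \<in> carrier Q"
        and ub: "\<And>d. d \<in> D \<Longrightarrow> f d \<sqsubseteq>\<^bsub>Q\<^esub> u" for D s u
    proof -
      have "d \<sqsubseteq>\<^bsub>P\<^esub> g u" if "d \<in> D" for d
        using ub[OF that] lef[of d u] u directed_in_subset[OF D] that by auto
      then have "s \<in> carrier P" "s \<sqsubseteq>\<^bsub>P\<^esub> g u"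
        using s gP[OF u] unfolding is_lub_iff[OF directed_in_subset[OF D]] by simp_all
      then show ?thesis using lef u by simp
    qed
  qed (use assms(3) le in auto)
  have g: "g \<in> scott_maps Q P"
  proof (rule scott_mapsI)
    show "partial_order P" "partial_order Q" by unfold_locales
    show "g \<in> carrier Q \<rightarrow>\<^sub>E carrier P" using gP by (auto simp: g_def)
    show "g x \<sqsubseteq>\<^bsub>P\<^esub> g y" if "x \<in> carrier Q" "y \<in> carrier Q" "x \<sqsubseteq>\<^bsub>Q\<^esub> y" for x y
      using that by (simp add: leg gP fg)
    show "g s \<sqsubseteq>\<^bsub>P\<^esub> u"
      if D: "directed_in Q D" and s: "is_lub Q s D" and u: "u \<in> carrier P"
        and ub: "\<And>d. d \<in> D \<Longrightarrow> g d \<sqsubseteq>\<^bsub>P\<^esub> u" for D s u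
    proof -
      have "d \<sqsubseteq>\<^bsub>Q\<^esub> f u" if "d \<in> D" for d
        using ub[OF that] leg[of d u] u directed_in_subset[OF D] that by auto
      then have "s \<in> carrier Q" "s \<sqsubseteq>\<^bsub>Q\<^esub> f u"
        using s fQ[OF u] unfolding is_lub_iff[OF directed_in_subset[OF D]] by simp_all
      then show ?thesis using leg u by simp
    qed
  qed
  show ?thesis
    unfolding dcpo_iso_def using assms(1,2) f g gf fg by blast
qed

section \<open>Scott-closed sets and maps into the two-element chain\<close>

definition scott_closed :: "'a gorder \<Rightarrow> 'a set \<Rightarrow> bool" where
  "scott_closed A F \<longleftrightarrow> F \<subseteq> carrier A \<and>
     (\<forall>x\<in>F. \<forall>y\<in>carrier A. y \<sqsubseteq>\<^bsub>A\<^esub> x \<longrightarrow> y \<in> F) \<and>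
     (\<forall>D s. directed_in A D \<longrightarrow> D \<subseteq> F \<longrightarrow> is_lub A s D \<longrightarrow> s \<in> F)"

lemma scott_closed_carrier: "scott_closed A (carrier A)"
  by (auto simp: scott_closed_def least_def Upper_def)

lemma scott_closed_le_preimage:
  assumes "partial_order B" "f \<in> scott_maps A B" "c \<in> carrier B"
  shows "scott_closed A {x \<in> carrier A. f x \<sqsubseteq>\<^bsub>B\<^esub> c}"
proof -
  interpret B: partial_order B by fact
  show ?thesis
    unfolding scott_closed_def
  proof (intro conjI ballI allI impI)
    fix x y
    assume "x \<in> {x \<in> carrier A. f x \<sqsubseteq>\<^bsub>B\<^esub> c}" "y \<in> carrier A" "y \<sqsubseteq>\<^bsub>A\<^esub> x"
    then show "y \<in> {x \<in> carrier A. f x \<sqsubseteq>\<^bsub>B\<^esub> c}"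
      using scott_maps_mono[OF assms(2), of y x] scott_maps_mem[OF assms(2)] assms(3)
      by (auto intro: B.le_trans)
  next
    fix D s
    assume D: "directed_in A D" "D \<subseteq> {x \<in> carrier A. f x \<sqsubseteq>\<^bsub>B\<^esub> c}" "is_lub A s D"
    then have "s \<in> carrier A" by (simp add: is_lub_iff[OF directed_in_subset])
    moreover have "f s \<sqsubseteq>\<^bsub>B\<^esub> c"
      using D(2) by (intro scott_maps_lub_le[OF assms(2) D(1,3) assms(3)]) auto
    ultimately show "s \<in> {x \<in> carrier A. f x \<sqsubseteq>\<^bsub>B\<^esub> c}" by simp
  qed auto
qed

lemma two_simps [simp]: "carrier two = UNIV" "le two x y \<longleftrightarrow> (x \<longrightarrow> y)"
  by (simp_all add: two_def)

lemma partial_order_two: "partial_order two"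
  by unfold_locales (auto simp: two_def)

lemma scott_closed_not:
  assumes "q \<in> scott_maps A two"
  shows "scott_closed A {x \<in> carrier A. \<not> q x}"
  using scott_closed_le_preimage[OF partial_order_two assms, of False] by simp

text \<open>This is the characteristic map of the open complement of \<open>F\<close>. Together with
  \<open>scott_closed_not\<close> it translates between closed sets and maps into
  \<open>two\<close>; the translation reverses the order.\<close>

lemma scott_maps_two_of_closed:
  assumes "partial_order A" "scott_closed A F"
  shows "(\<lambda>x\<in>carrier A. x \<notin> F) \<in> scott_maps A two"
proof (rule scott_mapsI)
  show "le two ((\<lambda>x\<in>carrier A. x \<notin> F) s) u"
    if D: "directed_in A D" and s: "is_lub A s D"
      and le: "\<And>d. d \<in> D \<Longrightarrow> le two ((\<lambda>x\<in>carrier A. x \<notin> F) d) u" for D s u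
  proof -
    have "s \<in> carrier A" using s is_lub_iff[OF directed_in_subset[OF D]] by blast
    \<comment> \<open>For true \<open>u\<close> there is nothing to show. For false \<open>u\<close>
      the bound says that the characteristic map is false on all of \<open>D\<close>, so
      \<open>D\<close> lies in \<open>F\<close>.\<close>
    moreover have "s \<in> F" if "\<not> u"
    proof -
      have "D \<subseteq> F"
      proof
        fix d
        assume "d \<in> D"
        then show "d \<in> F" using le[of d] that directed_in_subset[OF D] by (auto split: if_splits)
      qed
      then show ?thesis using assms(2) D s unfolding scott_closed_def by blast
    qed
    ultimately show ?thesis by auto
  qed
qed (use assms partial_order_two in \<open>auto simp: scott_closed_def\<close>)

section \<open>Scott-closed sets along a map in \<open>E2\<close>\<close>

lemma E2_scott_maps: "e \<in> E2 A B \<Longrightarrow> e \<in> scott_maps A B"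
  and E2_dcpo: "e \<in> E2 A B \<Longrightarrow> dcpo A" "e \<in> E2 A B \<Longrightarrow> dcpo B"
  by (simp_all add: E2_def)

lemma E2_mem: "e \<in> E2 A B \<Longrightarrow> a \<in> carrier A \<Longrightarrow> e a \<in> carrier B"
  by (blast intro: scott_maps_mem E2_scott_maps)

lemma E2_inverse:
  assumes "e \<in> E2 A B"
  obtains r where "r \<in> scott_maps (scott_space A two) (scott_space B two)"
    "\<And>q. q \<in> scott_maps B two \<Longrightarrow> r (precomp A B two e q) = q"
    "\<And>p. p \<in> scott_maps A two \<Longrightarrow> precomp A B two e (r p) = p"
proof -
  have "dcpo_iso (scott_space B two) (scott_space A two) (precomp A B two e)"
    using assms by (simp add: E2_def)
  then show thesis unfolding dcpo_iso_def scott_space_simps using that by blast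
qed

text \<open>The inverse of \<open>precomp A B two e\<close> is monotone, so inequalities between
  maps into \<open>two\<close> can be tested on the image of \<open>e\<close>. Since complements
  reverse inclusion, the inequality to test runs from the map of \<open>H\<close> to the map of
  \<open>G\<close>.\<close>

lemma E2_closed_mono:
  assumes e: "e \<in> E2 A B" and G: "scott_closed B G" "scott_closed B H"
    and le: "\<And>a. a \<in> carrier A \<Longrightarrow> e a \<in> G \<Longrightarrow> e a \<in> H"
  shows "G \<subseteq> H"
proof -
  interpret B: dcpo B using e by (rule E2_dcpo)
  let ?p = "precomp A B two e" and ?q = "\<lambda>F. \<lambda>x\<in>carrier B. x \<notin> F"
  have q: "?q G \<in> scott_maps B two" "?q H \<in> scott_maps B two"
    using scott_maps_two_of_closed[OF B.partial_order_axioms] G by auto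
  obtain r where r: "r \<in> scott_maps (scott_space A two) (scott_space B two)"
    "\<And>q. q \<in> scott_maps B two \<Longrightarrow> r (?p q) = q"
    using E2_inverse[OF e] by metis
  have p: "?p \<in> scott_maps (scott_space B two) (scott_space A two)"
    using e by (simp add: E2_def dcpo_iso_def)
  have pS: "?p q \<in> carrier (scott_space A two)" if "q \<in> scott_maps B two" for q
    using scott_maps_mem[OF p] that by simp
  have "le (scott_space A two) (?p (?q H)) (?p (?q G))"
    using q le E2_mem[OF e] by (auto simp: precomp_def compose_eq)
  then have "le (scott_space B two) (?q H) (?q G)"
    using scott_maps_mono[OF r(1) pS[OF q(2)] pS[OF q(1)]] r(2) q by simp
  then show ?thesis using G by (auto simp: scott_closed_def)
qed

text \<open>Surjectivity of \<open>precomp A B two e\<close>, applied to the characteristic map of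
  the complement of \<open>F\<close>; \<open>G\<close> is the zero set of the map \<open>q\<close>
  obtained.\<close>

lemma E2_closed_ex:
  assumes e: "e \<in> E2 A B" and F: "scott_closed A F"
  obtains G where "scott_closed B G" "\<And>a. a \<in> carrier A \<Longrightarrow> e a \<in> G \<longleftrightarrow> a \<in> F"
proof -
  interpret A: dcpo A using e by (rule E2_dcpo)
  let ?p = "\<lambda>x\<in>carrier A. x \<notin> F"
  have p: "?p \<in> scott_maps A two" by (rule scott_maps_two_of_closed[OF A.partial_order_axioms F])
  obtain r where "r \<in> scott_maps (scott_space A two) (scott_space B two)"
    "\<And>p. p \<in> scott_maps A two \<Longrightarrow> precomp A B two e (r p) = p"
    using E2_inverse[OF e] by metis
  then obtain q where q: "q \<in> scott_maps B two" "precomp A B two e q = ?p"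
    using p scott_maps_mem[of r "scott_space A two" "scott_space B two" ?p] by auto
  have "q (e a) \<longleftrightarrow> a \<notin> F" if "a \<in> carrier A" for a
    using fun_cong[OF q(2), of a] q(1) that by (simp add: precomp_def compose_eq)
  then show thesis
    using that[OF scott_closed_not[OF q(1)]] E2_mem[OF e] by auto
qed

section \<open>Preimages of principal ideals under a map in \<open>E2\<close>\<close>

definition fibre :: "'a gorder \<Rightarrow> 'b gorder \<Rightarrow> ('a \<Rightarrow> 'b) \<Rightarrow> 'b \<Rightarrow> 'a set" where
  "fibre A B e b = {a \<in> carrier A. e a \<sqsubseteq>\<^bsub>B\<^esub> b}"

lemma scott_closed_below:
  assumes "partial_order B" "b \<in> carrier B"
  shows "scott_closed B {x \<in> carrier B. x \<sqsubseteq>\<^bsub>B\<^esub> b}"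
proof -
  interpret B: partial_order B by fact
  show ?thesis using assms(2)
    by (auto simp: scott_closed_def is_lub_iff[OF directed_in_subset] intro: B.le_trans)
qed

text \<open>\<open>G\<close> is the closed set of \<open>B\<close> that corresponds to
  \<open>F\<close>. The principal ideal of \<open>b\<close> is Scott-closed, so by
  \<open>E2_closed_mono\<close> it lies in \<open>G\<close> as soon as its points of the form
  \<open>e a\<close> do, and that condition says that the fibre of \<open>b\<close> lies in
  \<open>F\<close>. Hence the \<open>b\<close> whose fibre lies in \<open>F\<close> form a
  Scott-closed set.\<close>

lemma E2_fibre_closed:
  assumes e: "e \<in> E2 A B" and F: "scott_closed A F"
  shows "\<exists>G. scott_closed B G \<and> (\<forall>a\<in>carrier A. e a \<in> G \<longleftrightarrow> a \<in> F) \<and>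
    (\<forall>b\<in>carrier B. fibre A B e b \<subseteq> F \<longleftrightarrow> b \<in> G)"
proof -
  interpret B: dcpo B using e by (rule E2_dcpo)
  obtain G where G: "scott_closed B G" "\<And>a. a \<in> carrier A \<Longrightarrow> e a \<in> G \<longleftrightarrow> a \<in> F"
    using E2_closed_ex[OF assms] by blast
  have "fibre A B e b \<subseteq> F \<longleftrightarrow> b \<in> G" if b: "b \<in> carrier B" for b
  proof
    assume "fibre A B e b \<subseteq> F"
    then have "e a \<in> G" if "a \<in> carrier A" "e a \<in> {x \<in> carrier B. x \<sqsubseteq>\<^bsub>B\<^esub> b}" for a
      using that G(2)[of a] by (auto simp: fibre_def)
    then have "{x \<in> carrier B. x \<sqsubseteq>\<^bsub>B\<^esub> b} \<subseteq> G"
      by (rule E2_closed_mono[OF e scott_closed_below[OF B.partial_order_axioms b] G(1)])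
    then show "b \<in> G" using b by auto
  next
    assume bG: "b \<in> G"
    show "fibre A B e b \<subseteq> F"
    proof
      fix a
      assume "a \<in> fibre A B e b"
      then have a: "a \<in> carrier A" "e a \<sqsubseteq>\<^bsub>B\<^esub> b" by (simp_all add: fibre_def)
      then have "e a \<in> G" using G(1) bG E2_mem[OF e] unfolding scott_closed_def by blast
      then show "a \<in> F" using G(2) a by simp
    qed
  qed
  with G show ?thesis by blast
qed

text \<open>The fibre of a directed supremum can exceed the union of the fibres, but it stays inside
  every Scott-closed set containing that union. This is what makes the extension below
  continuous.\<close>

lemma E2_fibre_lub:
  assumes e: "e \<in> E2 A B" and F: "scott_closed A F"
    and D: "directed_in B D" "is_lub B b D" "\<And>d. d \<in> D \<Longrightarrow> fibre A B e d \<subseteq> F"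
  shows "fibre A B e b \<subseteq> F"
proof -
  obtain G where G: "scott_closed B G" "\<forall>b\<in>carrier B. fibre A B e b \<subseteq> F \<longleftrightarrow> b \<in> G"
    using E2_fibre_closed[OF e F] by blast
  have DB: "D \<subseteq> carrier B" by (rule directed_in_subset) fact
  have "D \<subseteq> G" using D(3) DB G(2) by blast
  then have "b \<in> G" using G(1) D(1,2) unfolding scott_closed_def by blast
  then show ?thesis using G(2) D(2) is_lub_iff[OF DB] by blast
qed

text \<open>Points of \<open>A\<close> whose images lie below \<open>e a\<close> belong to every
  closed set containing \<open>a\<close>. With \<open>F\<close> the sublevel set of \<open>f\<close>
  at \<open>f a\<close>, this bounds \<open>f\<close> on the fibre of \<open>e a\<close> by
  \<open>f a\<close>.\<close>

lemma E2_fibre_image: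
  assumes e: "e \<in> E2 A B" and F: "scott_closed A F" and a: "a \<in> F"
  shows "fibre A B e (e a) \<subseteq> F"
proof -
  obtain G where "\<forall>a\<in>carrier A. e a \<in> G \<longleftrightarrow> a \<in> F"
    "\<forall>b\<in>carrier B. fibre A B e b \<subseteq> F \<longleftrightarrow> b \<in> G"
    using E2_fibre_closed[OF e F] by blast
  moreover have "a \<in> carrier A" using F a by (auto simp: scott_closed_def)
  ultimately show ?thesis using a E2_mem[OF e] by blast
qed

text \<open>For the fixed value \<open>c = h b\<close>, the sublevel sets of \<open>h\<close> and
  \<open>g\<close> at \<open>c\<close> are Scott-closed, and on the image of \<open>e\<close> the
  first is contained in the second. By \<open>E2_closed_mono\<close> the inclusion holds throughout
  \<open>B\<close>, and \<open>b\<close> lies in the first set.\<close>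

lemma E2_reflects_le:
  assumes e: "e \<in> E2 A B" and C: "partial_order C"
    and g: "g \<in> scott_maps B C" "h \<in> scott_maps B C"
    and le: "\<And>a. a \<in> carrier A \<Longrightarrow> g (e a) \<sqsubseteq>\<^bsub>C\<^esub> h (e a)" and b: "b \<in> carrier B"
  shows "g b \<sqsubseteq>\<^bsub>C\<^esub> h b"
proof -
  interpret C: partial_order C by fact
  have c: "h b \<in> carrier C" using g(2) b by (rule scott_maps_mem)
  have "{x \<in> carrier B. h x \<sqsubseteq>\<^bsub>C\<^esub> h b} \<subseteq> {x \<in> carrier B. g x \<sqsubseteq>\<^bsub>C\<^esub> h b}"
  proof (rule E2_closed_mono[OF e])
    fix a
    assume a: "a \<in> carrier A" and "e a \<in> {x \<in> carrier B. h x \<sqsubseteq>\<^bsub>C\<^esub> h b}"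
    then show "e a \<in> {x \<in> carrier B. g x \<sqsubseteq>\<^bsub>C\<^esub> h b}"
      using C.le_trans[OF le[OF a], of "h b"] scott_maps_mem[OF g(1)] scott_maps_mem[OF g(2)] c
      by simp
  qed (use scott_closed_le_preimage[OF C] g c in auto)
  then show ?thesis using b c by auto
qed

section \<open>Extension of maps into bounded-complete dcpos\<close>

lemma (in bounded_complete_dcpo) bounded_lub':
  assumes "S \<subseteq> carrier A" "u \<in> carrier A" "\<And>x. x \<in> S \<Longrightarrow> x \<sqsubseteq> u"
  shows "\<exists>s. is_lub A s S"
proof (cases "S = {}")
  \<comment> \<open>Every element bounds the empty set, so its supremum is the bottom element. The
    case arises for those \<open>b\<close> that have no \<open>e a\<close> below them.\<close>
  case True
  then show ?thesis using bottom_ex by (simp add: Upper_def)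
next
  case False
  moreover have "u \<in> Upper A S" using assms by (auto simp: Upper_def)
  ultimately show ?thesis using bounded_lub assms(1) by blast
qed

lemma E2_fibre_bounded:
  assumes e: "e \<in> E2 A B" and C: "bounded_complete_dcpo C" and f: "f \<in> scott_maps A C"
    and b: "b \<in> carrier B"
  shows "\<exists>s. is_lub C s (f ` fibre A B e b)"
proof -
  interpret B: dcpo B using e by (rule E2_dcpo)
  interpret C: bounded_complete_dcpo C by fact
  let ?K = "fibre A B e" and ?F = "\<lambda>c. {x \<in> carrier A. f x \<sqsubseteq>\<^bsub>C\<^esub> c}"
  have F: "scott_closed A (?F c)" if "c \<in> carrier C" for c
    using C.partial_order_axioms f that by (rule scott_closed_le_preimage)
  have Fmono: "?F c \<subseteq> ?F d" if "c \<sqsubseteq>\<^bsub>C\<^esub> d" "c \<in> carrier C" "d \<in> carrier C" for c d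
    using that scott_maps_mem[OF f] by (auto intro: C.le_trans)
  have KF: "?K x \<subseteq> ?F c \<longleftrightarrow> (\<forall>a\<in>?K x. f a \<sqsubseteq>\<^bsub>C\<^esub> c)" for x c
    by (auto simp: fibre_def)
  have sub: "f ` ?K x \<subseteq> carrier C" for x
    using scott_maps_mem[OF f] by (auto simp: fibre_def)
  have Kmono: "?K x \<subseteq> ?K y" if "x \<sqsubseteq>\<^bsub>B\<^esub> y" "x \<in> carrier B" "y \<in> carrier B" for x y
    using that E2_mem[OF e] by (auto simp: fibre_def intro: B.le_trans)
  have lub: "\<exists>s. is_lub C s (f ` ?K x)" if "c \<in> carrier C" "?K x \<subseteq> ?F c" for x c
    using sub that by (intro C.bounded_lub') auto
  let ?G = "{x \<in> carrier B. \<exists>c\<in>carrier C. ?K x \<subseteq> ?F c}"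
  have G: "scott_closed B ?G"
    unfolding scott_closed_def
  proof (intro conjI ballI allI impI)
    fix x y
    assume "x \<in> ?G" "y \<in> carrier B" "y \<sqsubseteq>\<^bsub>B\<^esub> x"
    then show "y \<in> ?G" using Kmono[of y x] by blast
  next
    fix D t
    assume D: "directed_in B D" "D \<subseteq> ?G" "is_lub B t D"
    then have "\<forall>d\<in>D. \<exists>s. is_lub C s (f ` ?K d)" using lub by blast
    \<comment> \<open>The bounds are taken least: arbitrary bounds for the various \<open>d\<close>
      need not form a directed set, whereas the suprema \<open>h d\<close> grow with
      \<open>d\<close>.\<close>
    then obtain h where h: "\<And>d. d \<in> D \<Longrightarrow> is_lub C (h d) (f ` ?K d)" by metis
    have DB: "D \<subseteq> carrier B" using D(1) by (rule directed_in_subset)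
    have hC: "h d \<in> carrier C" and hK: "?K d \<subseteq> ?F (h d)"
      and hle: "\<And>c. \<lbrakk>c \<in> carrier C; ?K d \<subseteq> ?F c\<rbrakk> \<Longrightarrow> h d \<sqsubseteq>\<^bsub>C\<^esub> c" if "d \<in> D" for d
      using h[OF that] unfolding is_lub_iff[OF sub] KF by auto
    have hD: "h ` D \<subseteq> carrier C" using hC by auto
    have "directed_in C (h ` D)"
    proof (rule directed_in_image[OF D(1) hD])
      fix x y
      assume xy: "x \<in> D" "y \<in> D" "x \<sqsubseteq>\<^bsub>B\<^esub> y"
      then have "?K x \<subseteq> ?F (h y)" using Kmono[OF xy(3)] hK[OF xy(2)] DB by blast
      then show "h x \<sqsubseteq>\<^bsub>C\<^esub> h y" using xy hC by (intro hle)
    qed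
    then obtain s where "is_lub C s (h ` D)" using C.directed_lub by blast
    then have s: "s \<in> carrier C" "\<And>d. d \<in> D \<Longrightarrow> h d \<sqsubseteq>\<^bsub>C\<^esub> s"
      unfolding is_lub_iff[OF hD] by auto
    have "?K t \<subseteq> ?F s"
    proof (rule E2_fibre_lub[OF e F[OF s(1)] D(1,3)])
      show "?K d \<subseteq> ?F s" if "d \<in> D" for d
        using hK[OF that] Fmono[OF s(2)[OF that] hC[OF that] s(1)] by blast
    qed
    then show "t \<in> ?G" using D(3) s(1) is_lub_iff[OF DB] by blast
  qed auto
  \<comment> \<open>The whole carrier is itself Scott-closed, so it suffices that \<open>?G\<close>
    contains the image of \<open>e\<close>; the bound at \<open>e a\<close> is
    \<open>f a\<close>.\<close>
  have "carrier B \<subseteq> ?G"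
  proof (rule E2_closed_mono[OF e scott_closed_carrier G])
    fix a
    assume a: "a \<in> carrier A"
    then have fa: "f a \<in> carrier C" using f by (blast intro: scott_maps_mem)
    then have "?K (e a) \<subseteq> ?F (f a)" using a by (intro E2_fibre_image[OF e F]) auto
    then show "e a \<in> ?G" using fa E2_mem[OF e a] by blast
  qed
  then show ?thesis using b lub by blast
qed

lemma E2_extension:
  assumes e: "e \<in> E2 A B" and C: "bounded_complete_dcpo C" and f: "f \<in> scott_maps A C"
  obtains g where "g \<in> scott_maps B C" "\<And>a. a \<in> carrier A \<Longrightarrow> g (e a) = f a"
proof -
  interpret A: dcpo A using e by (rule E2_dcpo)
  interpret B: dcpo B using e by (rule E2_dcpo)
  interpret C: bounded_complete_dcpo C by fact
  let ?K = "fibre A B e" and ?F = "\<lambda>c. {x \<in> carrier A. f x \<sqsubseteq>\<^bsub>C\<^esub> c}"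
  have F: "scott_closed A (?F c)" if "c \<in> carrier C" for c
    using C.partial_order_axioms f that by (rule scott_closed_le_preimage)
  have Fmono: "?F c \<subseteq> ?F d" if "c \<sqsubseteq>\<^bsub>C\<^esub> d" "c \<in> carrier C" "d \<in> carrier C" for c d
    using that scott_maps_mem[OF f] by (auto intro: C.le_trans)
  have sub: "f ` ?K x \<subseteq> carrier C" for x
    using scott_maps_mem[OF f] by (auto simp: fibre_def)
  obtain h where h: "\<And>b. b \<in> carrier B \<Longrightarrow> is_lub C (h b) (f ` ?K b)"
    using E2_fibre_bounded[OF e C f] by metis
  have hC: "h b \<in> carrier C" and hK: "\<And>a. a \<in> ?K b \<Longrightarrow> f a \<sqsubseteq>\<^bsub>C\<^esub> h b"
    and hle: "\<And>c. \<lbrakk>c \<in> carrier C; ?K b \<subseteq> ?F c\<rbrakk> \<Longrightarrow> h b \<sqsubseteq>\<^bsub>C\<^esub> c" if "b \<in> carrier B" for b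
    using h[OF that] unfolding is_lub_iff[OF sub] by (auto simp: subset_eq)
  have hKF: "?K b \<subseteq> ?F (h b)" if "b \<in> carrier B" for b
    using hK[OF that] by (auto simp: fibre_def)
  have "restrict h (carrier B) \<in> scott_maps B C"
  proof (rule scott_mapsI)
    show "partial_order B" "partial_order C" by unfold_locales
    show "restrict h (carrier B) \<in> carrier B \<rightarrow>\<^sub>E carrier C" using hC by auto
    show "restrict h (carrier B) x \<sqsubseteq>\<^bsub>C\<^esub> restrict h (carrier B) y"
      if xy: "x \<in> carrier B" "y \<in> carrier B" "x \<sqsubseteq>\<^bsub>B\<^esub> y" for x y
    proof -
      have "?K x \<subseteq> ?K y"
        using xy E2_mem[OF e] by (auto simp: fibre_def intro: B.le_trans)
      then show ?thesis using xy hKF[OF xy(2)] hC by (simp add: hle)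
    qed
    show "restrict h (carrier B) s \<sqsubseteq>\<^bsub>C\<^esub> u"
      if D: "directed_in B D" and s: "is_lub B s D" and u: "u \<in> carrier C"
        and le: "\<And>d. d \<in> D \<Longrightarrow> restrict h (carrier B) d \<sqsubseteq>\<^bsub>C\<^esub> u" for D s u
    proof -
      \<comment> \<open>The bound on the values \<open>h d\<close> is restated as inclusion of the
        fibres in the closed set \<open>?F u\<close>, the form in which it passes to the supremum
        \<open>s\<close>.\<close>
      have "?K d \<subseteq> ?F u" if "d \<in> D" for d
      proof -
        have d: "d \<in> carrier B" using that directed_in_subset[OF D] by auto
        then show ?thesis
          using hKF[OF d] Fmono[OF _ hC[OF d] u] le[OF that] by auto
      qed
      then have "?K s \<subseteq> ?F u" by (rule E2_fibre_lub[OF e F[OF u] D s])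
      moreover have "s \<in> carrier B" using s is_lub_iff[OF directed_in_subset[OF D]] by blast
      ultimately show ?thesis using u by (simp add: hle)
    qed
  qed
  moreover have "restrict h (carrier B) (e a) = f a" if a: "a \<in> carrier A" for a
  proof -
    have ea: "e a \<in> carrier B" and fa: "f a \<in> carrier C"
      using a E2_mem[OF e] scott_maps_mem[OF f] by auto
    \<comment> \<open>Thus \<open>f a\<close> bounds \<open>f\<close> on the fibre of
      \<open>e a\<close>. Since \<open>a\<close> itself belongs to that fibre, \<open>f a\<close> is
      the greatest value there and so equals the supremum.\<close>
    have "?K (e a) \<subseteq> ?F (f a)" using a fa by (intro E2_fibre_image[OF e F]) auto
    then have "h (e a) \<sqsubseteq>\<^bsub>C\<^esub> f a" using ea fa by (simp add: hle)
    moreover have "f a \<sqsubseteq>\<^bsub>C\<^esub> h (e a)" using a ea by (intro hK) (auto simp: fibre_def)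
    ultimately show ?thesis using ea fa hC by (auto intro: C.le_antisym)
  qed
  ultimately show thesis by (rule that)
qed

section \<open>Restriction along \<open>e\<close> as an isomorphism of function spaces\<close>

theorem corollary4p11:
  fixes C :: "'c gorder"
  assumes "bounded_complete_dcpo C"
  shows "C \<in> R2 TYPE('a) TYPE('b)"
proof -
  interpret C: bounded_complete_dcpo C by fact
  have C: "dcpo C" by unfold_locales
  have "dcpo_iso (scott_space B C) (scott_space A C) (precomp A B C e)"
    if e: "e \<in> E2 A B" for A :: "'a gorder" and B :: "'b gorder" and e
  proof (rule dcpo_iso_of_order_iso)
    note dcpos = E2_dcpo[OF e] C
    show "dcpo (scott_space B C)" "dcpo (scott_space A C)"
      using dcpos by (simp_all add: dcpo_scott_space)
    have comp: "compose (carrier A) g e \<in> scott_maps A C" if "g \<in> scott_maps B C" for g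
      using dcpos E2_scott_maps[OF e] that by (rule compose_scott_maps)
    then show "precomp A B C e \<in> carrier (scott_space B C) \<rightarrow>\<^sub>E carrier (scott_space A C)"
      by (auto simp: precomp_def)
    show "carrier (scott_space A C) \<subseteq> precomp A B C e ` carrier (scott_space B C)"
    proof
      fix f
      assume "f \<in> carrier (scott_space A C)"
      then have f: "f \<in> scott_maps A C" by simp
      obtain g where g: "g \<in> scott_maps B C" "\<And>a. a \<in> carrier A \<Longrightarrow> g (e a) = f a"
        using E2_extension[OF e assms f] by blast
      have "compose (carrier A) g e = f"
        using comp[OF g(1)] f by (rule scott_maps_ext) (simp add: compose_eq g(2))
      then show "f \<in> precomp A B C e ` carrier (scott_space B C)"
        using g(1) by (auto simp: precomp_def)
    qed
    \<comment> \<open>From left to right this is \<open>E2_reflects_le\<close>, which also yields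
      uniqueness of extensions; conversely the inequality is evaluated at the points
      \<open>e a\<close>.\<close>
    show "le (scott_space A C) (precomp A B C e g) (precomp A B C e h)
        \<longleftrightarrow> le (scott_space B C) g h"
      if "g \<in> carrier (scott_space B C)" "h \<in> carrier (scott_space B C)" for g h
      using that E2_reflects_le[OF e C.partial_order_axioms, of g h] E2_mem[OF e]
      by (auto simp: precomp_def compose_eq)
  qed
  then show ?thesis using C by (simp add: R2_def)
qed

end
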